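(* Let $\mathbb{A}_n:\Theta_n\to X^X$, $b_n:\Theta_n\to X$ and $L_n:\Theta_n\to(0,\infty)$, $n\in\mathbb{N}$, be such that, for every $n\in\mathbb{N}$, the functions $\mathbb{A}_n(\theta):X\to X$, $\theta\in\Theta_n$, are invertible continuous linear operators, and the mappings $b_n$, $L_n$, $X\times\Theta_n\ni(x,\theta)\mapsto\mathbb{A}_n(\theta)(x)\in X$, $\Theta_n\ni\theta\mapsto\|\mathbb{A}_n(\theta)\|_{\mathrm{op}}\in\mathbb{R}$ and $\Theta_n\ni\theta\mapsto\|\mathbb{A}_n(\theta)^{-1}\|_{\mathrm{op}}\in\mathbb{R}$ are measurable. Suppose that: (B1) $\|\mathbb{A}_n(\theta)\|_{\mathrm{op}}\le L_n(\theta)$ for any $\theta\in\Theta_n$ and $n\in\mathbb{N}$; (B2) for every Borel set $E\subset(0,\infty)$, $\vartheta_n(L_n^{-1}(E))$ does not depend on $n$, and $R:=\int_{\Theta_1}L_1(\theta)\,\vartheta_1(d\theta)<\infty$, $\int_{\Theta_1}\ln L_1(\theta)\,\vartheta_1(d\theta)<0$; (B3) for every $n\in\mathbb{N}$, the integrals $$\alpha_n:=\int_{\Theta_n}\|\mathbb{A}_n(\theta)^{-1}\|_{\mathrm{op}}\,\vartheta_n(d\theta),\quad \beta_n:=\int_{\Theta_n}\|b_n(\theta)\|\,\|\mathbb{A}_n(\theta)^{-1}\|_{\mathrm{op}}\,\vartheta_n(d\theta),$$ $$\delta_n:=\int_{\Theta_n}\|\mathbb{A}_n(\theta)\|_{\mathrm{op}}\|\mathbb{A}_n(\theta)^{-1}\|_{\mathrm{op}}\,\vartheta_n(d\theta),\quad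 \gamma_n:=\int_{\Theta_n}\|b_n(\theta)\|\,\vartheta_n(d\theta)$$ are finite, and $$\prod_{n=1}^\infty\delta_n<\infty,\quad \sum_{n=1}^\infty\frac{\beta_n}{\delta_n}\prod_{j=1}^{n-1}\frac{\alpha_j}{\delta_j}<\infty,\quad \sup_{n\in\mathbb{N}}\gamma_n\prod_{j=1}^{n-1}\alpha_j<\infty.$$ Consider the affine transformations $S_\theta^{(n)}(x):=\mathbb{A}_n(\theta)(x)+b_n(\theta)$ for $x\in X$, $n\in\mathbb{N}$, $\theta\in\Theta_n$. Then there exist a measure $\pi\in\mathcal{M}_1(X)$, a point $x_0\in X$ and constants $q\in(0,1)$, $C\in[0,\infty)$ such that $$d_{BL}\big(\mu P^{(n)},\pi\big)\le Cq^n\Big(1+\int_X\|x-x_0\|\,\mu(dx)\Big)\quad\text{for any }\mu\in\mathcal{M}_{1,1}(X),\ n\in\mathbb{N},$$ and, in particular, $\mu P^{(n)}$ converges weakly to $\pi$ as $n\to\infty$ for every $\mu\in\mathcal{M}_1(X)$. If additionally $R<1$, then $\pi\in\mathcal{M}_{1,1}(X)$.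
   Context: $\{(\Theta_n,\mathcal{A}_n,\vartheta_n)\}_{n\in\mathbb{N}}$ is an arbitrary sequence of probability spaces; $(X,\|\cdot\|)$ is a separable Banach space over $\mathbb{K}\in\{\mathbb{R},\mathbb{C}\}$, with metric $\rho(x,y)=\|x-y\|$ and Borel $\sigma$-field $\mathcal{B}(X)$; $\|\cdot\|_{\mathrm{op}}$ is the operator norm on continuous linear operators $X\to X$; $X^X$ is the set of all maps $X\to X$. $\mathcal{M}_1(X)$ is the set of Borel probability measures on $X$; $\mathcal{M}_{1,1}(X)$ is the set of those with $\int_X\|x\|\,\mu(dx)<\infty$. $d_{BL}(\mu,\nu):=\sup|\int f\,d\mu-\int f\,d\nu|$, the supremum being over all $f:X\to[-1,1]$ that are Lipschitz with constant at most $1$. Weak convergence means convergence of integrals of all bounded continuous functions. $P_n(x,A):=\int_{\Theta_n}\mathbf{1}_A(S_\theta^{(n)}(x))\,\vartheta_n(d\theta)$; $\mu P_n(A):=\int_X P_n(x,A)\,\mu(dx)$; $\mu P^{(n)}:=\mu P_1P_2\cdots P_n$ (apply $P_1$ first). Thus $\mu P^{(n)}$ is the law at time $n$ of the Markov chain $\Phi_n=S_{\eta_n}^{(n)}(\Phi_{n-1})$, $\Phi_0\sim\mu$, with $\eta_k\sim\vartheta_k$ mutually independent and independent of $\Phi_0$. Empty products equal $1$. *)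

theory Defs
  imports "HOL-Probability.Probability"
begin

text \<open>
  A normed space over the scalar field \<open>'k\<close>, whose underlying real normed space is given by the type
  class. The instances of \<^class>\<open>real_normed_field\<close> include \<^typ>\<open>real\<close> and \<^typ>\<open>complex\<close>, and by
  the Gelfand--Mazur theorem these are, up to isometric isomorphism, the only ones.
\<close>

locale normed_space_over = vector_space scale
  for scale :: "'k::real_normed_field \<Rightarrow> 'a::real_normed_vector \<Rightarrow> 'a" +
  assumes scale_of_real: "scale (of_real r) x = r *\<^sub>R x"
    and norm_scale: "norm (scale c x) = norm c * norm x"

lemma normed_space_over_real:
  "normed_space_over (scaleR :: real \<Rightarrow> 'a::real_normed_vector \<Rightarrow> 'a)"
  by unfold_locales (simp_all add: algebra_simps)

lemma normed_space_over_complex: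
  "normed_space_over ((*) :: complex \<Rightarrow> complex \<Rightarrow> complex)"
  by unfold_locales (simp_all add: algebra_simps norm_mult scaleR_conv_of_real)


definition borel_probs :: "'a::topological_space measure set"
  where "borel_probs = {\<mu>. prob_space \<mu> \<and> sets \<mu> = sets borel}"

definition borel_probs_fm :: "'a::real_normed_vector measure set"
  where "borel_probs_fm = {\<mu> \<in> borel_probs. integrable \<mu> norm}"

definition dist_BL :: "'a::metric_space measure \<Rightarrow> 'a measure \<Rightarrow> real"
  where "dist_BL \<mu> \<nu> =
    (SUP f \<in> {f. (\<forall>x. f x \<in> {-1..1}) \<and> 1-lipschitz_on UNIV f}.
      \<bar>(LINT x|\<mu>. f x) - (LINT x|\<nu>. f x)\<bar>)"

text \<open>The library's \<open>weak_conv_m\<close> is restricted to measures on the real line.\<close>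

definition weakly_converges :: "(nat \<Rightarrow> 'a::topological_space measure) \<Rightarrow> 'a measure \<Rightarrow> bool"
  where "weakly_converges \<mu>s \<mu> \<longleftrightarrow>
    (\<forall>f :: 'a \<Rightarrow> real. continuous_on UNIV f \<and> bounded (range f) \<longrightarrow>
      (\<lambda>n. LINT x|\<mu>s n. f x) \<longlonglongrightarrow> (LINT x|\<mu>. f x))"


definition trans_kernel :: "'t measure \<Rightarrow> ('t \<Rightarrow> 'a \<Rightarrow> 'a) \<Rightarrow> 'a \<Rightarrow> 'a set \<Rightarrow> ennreal"
  where "trans_kernel M S x A = (\<integral>\<^sup>+\<theta>. indicator A (S \<theta> x) \<partial>M)"

definition apply_kernel ::
    "'a::topological_space measure \<Rightarrow> ('a \<Rightarrow> 'a set \<Rightarrow> ennreal) \<Rightarrow> 'a measure"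
  where "apply_kernel \<mu> P = measure_of UNIV (sets borel) (\<lambda>A. \<integral>\<^sup>+x. P x A \<partial>\<mu>)"

text \<open>
  \<^const>\<open>measure_of\<close> yields the zero measure unless the given set function is countably additive; for
  the kernels at hand it is.
\<close>

lemma emeasure_apply_kernel:
  fixes \<mu> :: "'a::topological_space measure"
  assumes \<mu>: "sets \<mu> = sets borel" and M: "prob_space M"
    and S: "(\<lambda>(x, \<theta>). S \<theta> x) \<in> borel \<Otimes>\<^sub>M M \<rightarrow>\<^sub>M borel" and A: "A \<in> sets borel"
  shows "emeasure (apply_kernel \<mu> (trans_kernel M S)) A = (\<integral>\<^sup>+x. trans_kernel M S x A \<partial>\<mu>)"
proof -
  interpret M: prob_space M by fact
  have spx: "space \<mu> = UNIV"
    using sets_eq_imp_space_eq[OF \<mu>] by simp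
  have S\<mu>: "(\<lambda>(x, \<theta>). S \<theta> x) \<in> \<mu> \<Otimes>\<^sub>M M \<rightarrow>\<^sub>M borel"
    using S by (simp add: measurable_cong_sets[OF sets_pair_measure_cong[OF \<mu> refl] refl])
  have m1: "(\<lambda>\<theta>. S \<theta> x) \<in> M \<rightarrow>\<^sub>M borel" for x
    using measurable_compose[OF measurable_Pair1'[of x borel M] S] by simp
  have m2: "(\<lambda>x. trans_kernel M S x B) \<in> borel_measurable \<mu>" if B: "B \<in> sets borel" for B
  proof -
    have "(\<lambda>z. indicator B (case z of (x, \<theta>) \<Rightarrow> S \<theta> x) :: ennreal) \<in> borel_measurable (\<mu> \<Otimes>\<^sub>M M)"
      by (rule measurable_compose[OF S\<mu>]) (use B in simp)
    then have "(\<lambda>(x, \<theta>). indicator B (S \<theta> x) :: ennreal) \<in> borel_measurable (\<mu> \<Otimes>\<^sub>M M)"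
      by (simp add: split_def)
    from M.borel_measurable_nn_integral[OF this] show ?thesis
      unfolding trans_kernel_def .
  qed
  show ?thesis
    unfolding apply_kernel_def
  proof (rule emeasure_measure_of_sigma)
    show "sigma_algebra UNIV (sets (borel :: 'a measure))"
      using sets.sigma_algebra_axioms[of "borel :: 'a measure"] by simp
    show "positive (sets (borel :: 'a measure)) (\<lambda>A. \<integral>\<^sup>+x. trans_kernel M S x A \<partial>\<mu>)"
      by (simp add: positive_def trans_kernel_def)
    show "countably_additive (sets borel) (\<lambda>A. \<integral>\<^sup>+x. trans_kernel M S x A \<partial>\<mu>)"
    proof (rule countably_additiveI)
      fix F :: "nat \<Rightarrow> 'a set"
      assume F: "range F \<subseteq> sets borel" "disjoint_family F"
      have Fi: "F i \<in> sets borel" for i using F by auto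
      have *: "(\<Sum>i. trans_kernel M S x (F i)) = trans_kernel M S x (\<Union>i. F i)" for x
      proof -
        have "(\<Sum>i. trans_kernel M S x (F i)) = (\<integral>\<^sup>+\<theta>. (\<Sum>i. indicator (F i) (S \<theta> x)) \<partial>M)"
          unfolding trans_kernel_def
          by (rule nn_integral_suminf[symmetric])
            (rule measurable_compose[OF m1[of x] borel_measurable_indicator[OF Fi]])
        then show ?thesis
          by (simp add: trans_kernel_def suminf_indicator[OF F(2)])
      qed
      have "(\<Sum>i. \<integral>\<^sup>+x. trans_kernel M S x (F i) \<partial>\<mu>) =
          (\<integral>\<^sup>+x. (\<Sum>i. trans_kernel M S x (F i)) \<partial>\<mu>)"
        by (rule nn_integral_suminf[symmetric]) (rule m2[OF Fi])
      then show "(\<Sum>i. \<integral>\<^sup>+x. trans_kernel M S x (F i) \<partial>\<mu>) =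
          (\<integral>\<^sup>+x. trans_kernel M S x (\<Union>i. F i) \<partial>\<mu>)"
        by (simp add: *)
    qed
  qed (fact A)
qed

text \<open>The law at time \<open>n\<close>; the steps are numbered from \<open>1\<close>, so \<open>M 0\<close> and \<open>S 0\<close> are never used.\<close>

primrec chain_law ::
    "(nat \<Rightarrow> 't measure) \<Rightarrow> (nat \<Rightarrow> 't \<Rightarrow> 'a \<Rightarrow> 'a) \<Rightarrow> 'a::topological_space measure \<Rightarrow> nat \<Rightarrow> 'a measure"
  where
    "chain_law M S \<mu> 0 = \<mu>"
  | "chain_law M S \<mu> (Suc n) =
      apply_kernel (chain_law M S \<mu> n) (trans_kernel (M (Suc n)) (S (Suc n)))"


text \<open>
  The integral of a measurable function with integrable positive part, which may take the value
  \<open>-\<infinity>\<close> (whereas the Bochner integral of a non-integrable function is \<open>0\<close> by convention).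
\<close>

definition ext_integral :: "'t measure \<Rightarrow> ('t \<Rightarrow> real) \<Rightarrow> ereal"
  where "ext_integral M f =
    enn2ereal (\<integral>\<^sup>+\<theta>. ennreal (f \<theta>) \<partial>M) - enn2ereal (\<integral>\<^sup>+\<theta>. ennreal (- f \<theta>) \<partial>M)"

end

theory Submission
  imports Defs
begin

text \<open>
  The limit is the Dirac measure at \<open>0\<close>. If \<open>X \<noteq> {0}\<close>, then \<open>\<parallel>A\<^sup>-\<^sup>1\<parallel> \<ge> 1 / \<parallel>A\<parallel> \<ge> 1 / L\<close>, so every \<open>\<alpha>\<^sub>n\<close> is at least
  \<open>a = E (1 / L\<^sub>1) \<ge> 1 - E (ln L\<^sub>1) > 1\<close>, and the boundedness of \<open>\<gamma>\<^sub>n \<alpha>\<^sub>1 \<dots> \<alpha>\<^sub>n\<^sub>-\<^sub>1\<close> forces the means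
  \<open>\<gamma>\<^sub>n\<close> of the translations to decay like \<open>1 / a\<^sup>n\<close>. In particular \<open>ln L\<^sub>1\<close> is integrable, and since
  \<open>(L\<^sub>1\<^sup>s - 1) / s\<close> tends to \<open>ln L\<^sub>1\<close> dominatedly as \<open>s\<close> tends to \<open>0\<close>, some \<open>s \<in> (0, 1]\<close> satisfies
  \<open>r = E (L\<^sub>1\<^sup>s) < 1\<close>. By subadditivity of \<open>t \<mapsto> t\<^sup>s\<close> the moments
  \<open>E (\<parallel>\<Phi>\<^sub>n\<parallel>\<^sup>s) \<le> r E (\<parallel>\<Phi>\<^sub>n\<^sub>-\<^sub>1\<parallel>\<^sup>s) + E (\<parallel>b\<^sub>n\<parallel>\<^sup>s)\<close> decay exponentially, and twice \<open>E (\<parallel>\<Phi>\<^sub>n\<parallel>\<^sup>s)\<close> dominates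
  the bounded Lipschitz distance to the Dirac measure.
\<close>

section \<open>Boundedness of inverses of bounded linear bijections\<close>

text \<open>
  The quantitative form of the open mapping theorem. It is needed because \<^const>\<open>onorm\<close> of the inverse
  is a meaningless supremum as long as the inverse is not known to be bounded.
\<close>

lemma bounded_linear_surj_preimage_bound:
  fixes f :: "'a::banach \<Rightarrow> 'b::banach"
  assumes f: "bounded_linear f" and "surj f"
  obtains K where "\<And>z. \<exists>x. f x = z \<and> norm x \<le> K * norm z"
proof -
  interpret f: bounded_linear f by fact
  define T where "T n = closure (f ` cball 0 (real n))" for n
  have "z \<in> (\<Union>n. T n)" for z
  proof -
    obtain x where "z = f x" using \<open>surj f\<close> by blast
    moreover obtain n where "norm x \<le> real n" using real_arch_simple by blast
    ultimately show ?thesis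
      unfolding T_def using closure_subset by fastforce
  qed
  then have T_UN: "(\<Union>n. T n) = UNIV" by blast
  \<comment> \<open>The closed sets \<open>T n\<close> cover a complete space, so by Baire's theorem
    they cannot all have empty interior.\<close>
  obtain n where "interior (T n) \<noteq> {}"
  proof (rule ccontr)
    assume "\<not> thesis"
    with that have int: "interior (T n) = {}" for n by blast
    have "euclidean interior_of \<Union>(range T) = {}"
      by (rule Baire_category_alt)
        (use int in \<open>auto simp: completely_metrizable_space_euclidean T_def\<close>)
    then show False by (simp add: T_UN)
  qed
  then obtain y where "y \<in> interior (T n)" by blast
  then obtain e where e: "e > 0" "ball y e \<subseteq> T n" unfolding mem_interior by blast
  \<comment> \<open>Both \<open>y\<close> and \<open>y + z\<close> lie in the ball inside
    \<open>T n\<close>. Subtracting their approximate preimages, each of norm at most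
    \<open>n\<close>, gives an approximate preimage of \<open>z\<close> of norm at most
    \<open>2 * n\<close>, with arbitrarily small error.\<close>
  have approx: "\<exists>x. norm x \<le> 2 * real n \<and> norm (z - f x) \<le> \<eta>" if "norm z < e" "\<eta> > 0" for z \<eta>
  proof -
    have *: "\<exists>x. norm x \<le> real n \<and> norm (w - f x) < \<eta> / 2" if "w \<in> T n" for w
      using that \<open>\<eta> > 0\<close> unfolding T_def closure_approachable
      by (auto simp: dist_norm norm_minus_commute dest!: spec[of _ "\<eta> / 2"])
    have "y \<in> T n" "y + z \<in> T n" using e that by (auto simp: dist_norm)
    then obtain u v where u: "norm u \<le> real n" "norm (y - f u) < \<eta> / 2"
      and v: "norm v \<le> real n" "norm (y + z - f v) < \<eta> / 2"
      using * by meson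
    have "norm (z - f (v - u)) = norm ((y + z - f v) - (y - f u))"
      by (simp add: f.diff algebra_simps)
    also have "\<dots> \<le> \<eta> / 2 + \<eta> / 2"
      using norm_triangle_ineq4[of "y + z - f v" "y - f u"] u v by linarith
    finally have "norm (z - f (v - u)) \<le> \<eta>" by simp
    moreover have "norm (v - u) \<le> 2 * real n"
      using norm_triangle_ineq4[of v u] u v by linarith
    ultimately show ?thesis by blast
  qed
  \<comment> \<open>A nonzero \<open>z\<close> is rescaled by \<open>c\<close> to norm
    \<open>e / 2\<close>, where \<open>approx\<close> applies. Undoing the scaling turns the bound
    \<open>2 * n\<close> into \<open>4 * n / e * norm z\<close>.\<close>
  define K where "K = 4 * real n / e"
  have "K \<ge> 0" using e by (simp add: K_def)
  have "\<exists>x. norm x \<le> K * norm z \<and> norm (z - f x) \<le> norm z / 2" for z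
  proof (cases "z = 0")
    case True
    then show ?thesis by (auto intro!: exI[of _ 0] simp: f.zero)
  next
    case False
    define c where "c = e / (2 * norm z)"
    have c: "c > 0" using False e by (simp add: c_def)
    have "norm (c *\<^sub>R z) < e" using False e by (simp add: c_def)
    moreover have "c * norm z / 2 > 0" using False c by simp
    ultimately obtain x where x: "norm x \<le> 2 * real n" "norm (c *\<^sub>R z - f x) \<le> c * norm z / 2"
      using approx by blast
    have "norm (x /\<^sub>R c) \<le> K * norm z"
      using x(1) c e False by (simp add: c_def K_def field_simps)
    moreover have "c * norm (z - f (x /\<^sub>R c)) = norm (c *\<^sub>R (z - f (x /\<^sub>R c)))"
      using c by simp
    then have "c * norm (z - f (x /\<^sub>R c)) = norm (c *\<^sub>R z - f x)"
      using c by (simp add: f.scale scaleR_diff_right)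
    with x(2) have "c * norm (z - f (x /\<^sub>R c)) \<le> c * (norm z / 2)" by simp
    then have "norm (z - f (x /\<^sub>R c)) \<le> norm z / 2" using c by simp
    ultimately show ?thesis by blast
  qed
  then obtain h where h: "\<And>z. norm (h z) \<le> K * norm z" "\<And>z. norm (z - f (h z)) \<le> norm z / 2"
    by metis
  have "\<exists>x. f x = z \<and> norm x \<le> 2 * K * norm z" for z
  proof -
    \<comment> \<open>\<open>w k\<close> is the residual after \<open>k\<close> corrections. Each
      correction halves it, so the corrections \<open>h (w k)\<close> form a geometrically dominated
      series whose sum is an exact preimage of \<open>z\<close>.\<close>
    define w where "w k = ((\<lambda>z. z - f (h z)) ^^ k) z" for k
    have w_Suc: "w (Suc k) = w k - f (h (w k))" and w_0: "w 0 = z" for k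
      by (simp_all add: w_def)
    have w_le: "norm (w k) \<le> norm z * (1 / 2) ^ k" for k
    proof (induction k)
      case (Suc k)
      then show ?case using h(2)[of "w k"] by (simp add: w_Suc)
    qed (simp add: w_0)
    have hw_le: "norm (h (w k)) \<le> K * norm z * (1 / 2) ^ k" for k
      using h(1)[of "w k"] mult_left_mono[OF w_le[of k] \<open>K \<ge> 0\<close>] by (simp add: mult.assoc)
    have geo: "(\<lambda>k. K * norm z * (1 / 2) ^ k) sums (K * norm z * 2)"
      using sums_mult[OF geometric_sums[of "1 / 2 :: real"]] by simp
    have sn: "summable (\<lambda>k. norm (h (w k)))"
      by (rule summable_comparison_test'[OF sums_summable[OF geo]]) (use hw_le in simp)
    have "(\<lambda>k. f (h (w k))) sums f (\<Sum>k. h (w k))"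
      by (intro f.sums summable_sums summable_norm_cancel[OF sn])
    moreover have "w \<longlonglongrightarrow> 0"
    proof (rule Lim_null_comparison)
      show "\<forall>\<^sub>F k in sequentially. norm (w k) \<le> norm z * (1 / 2) ^ k" using w_le by simp
      show "(\<lambda>k. norm z * (1 / 2) ^ k) \<longlonglongrightarrow> 0" by (intro tendsto_mult_right_zero LIMSEQ_power_zero) simp
    qed
    then have "(\<lambda>k. f (h (w k))) sums z"
      using telescope_sums'[of w 0] by (simp add: w_Suc w_0)
    ultimately have "f (\<Sum>k. h (w k)) = z" by (rule sums_unique2)
    moreover have "norm (\<Sum>k. h (w k)) \<le> (\<Sum>k. norm (h (w k)))"
      by (rule summable_norm[OF sn])
    moreover have "(\<Sum>k. norm (h (w k))) \<le> K * norm z * 2"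
      using suminf_le[OF hw_le sn sums_summable[OF geo]] sums_unique[OF geo] by simp
    ultimately show ?thesis by (intro exI[of _ "\<Sum>k. h (w k)"]) simp
  qed
  then show ?thesis by (rule that)
qed

text \<open>By injectivity the preimage of controlled norm can only be \<open>inv f z\<close>, so
  \<open>K\<close> bounds the inverse.\<close>

lemma bounded_linear_inv:
  fixes f :: "'a::banach \<Rightarrow> 'b::banach"
  assumes f: "bounded_linear f" and "bij f"
  shows "bounded_linear (inv f)"
proof -
  interpret f: bounded_linear f by fact
  have inj: "inj f" and surj: "surj f" using \<open>bij f\<close> by (auto simp: bij_def)
  have f_inv: "f (inv f z) = z" for z by (rule surj_f_inv_f[OF surj])
  obtain K where K: "\<And>z. \<exists>x. f x = z \<and> norm x \<le> K * norm z"
    using bounded_linear_surj_preimage_bound[OF f surj] by blast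
  show ?thesis
  proof (rule bounded_linear_intro[where K = K])
    show "inv f (x + y) = inv f x + inv f y" for x y
      by (rule injD[OF inj]) (simp add: f_inv f.add)
    show "inv f (r *\<^sub>R x) = r *\<^sub>R inv f x" for r x
      by (rule injD[OF inj]) (simp add: f_inv f.scale)
    show "norm (inv f z) \<le> norm z * K" for z
      using K[of z] inj by (auto simp: mult.commute)
  qed
qed

text \<open>Estimate \<open>norm x\<close> through \<open>x = inv f (f x)\<close> and cancel it,
  which is possible since \<open>x\<close> is nonzero. On the trivial space both operator norms are
  0.\<close>

lemma one_le_onorm_mult_onorm_inv:
  fixes f :: "'a::banach \<Rightarrow> 'b::banach"
  assumes f: "bounded_linear f" and "bij f" and "x \<noteq> (0::'a)"
  shows "1 \<le> onorm f * onorm (inv f)"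
proof -
  have "norm x = norm (inv f (f x))" using \<open>bij f\<close> by (simp add: bij_def)
  also have "\<dots> \<le> onorm (inv f) * norm (f x)"
    by (rule onorm[OF bounded_linear_inv[OF f \<open>bij f\<close>]])
  also have "\<dots> \<le> onorm (inv f) * (onorm f * norm x)"
    by (intro mult_left_mono onorm f onorm_pos_le bounded_linear_inv \<open>bij f\<close>)
  finally have "1 * norm x \<le> (onorm f * onorm (inv f)) * norm x" by (simp add: mult_ac)
  then show ?thesis using \<open>x \<noteq> 0\<close> by (simp add: mult_le_cancel_right)
qed

section \<open>Small fractional moments and logarithmic moments\<close>

text \<open>The lower bound is exp t \<ge> 1 + t at \<open>t = s * ln x\<close>; the upper one is
  convexity of exp between 0 and \<open>ln x\<close>. Both are uniform in \<open>s\<close>, as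
  dominated convergence requires.\<close>

lemma powr_minus_one_bounds:
  fixes x s :: real
  assumes "x > 0" "0 < s" "s \<le> 1"
  shows "ln x \<le> (x powr s - 1) / s" and "(x powr s - 1) / s \<le> x - 1"
proof -
  have "1 + s * ln x \<le> x powr s"
    using exp_ge_add_one_self[of "s * ln x"] \<open>x > 0\<close> by (simp add: powr_def)
  then show "ln x \<le> (x powr s - 1) / s" using \<open>0 < s\<close> by (simp add: field_simps)
  have "x powr s \<le> (1 - s) * exp 0 + s * exp (ln x)"
    using convex_onD[OF exp_convex, of s 0 "ln x"] assms by (simp add: powr_def)
  then have "x powr s - 1 \<le> s * (x - 1)" using \<open>x > 0\<close> by (simp add: algebra_simps)
  then show "(x powr s - 1) / s \<le> x - 1" using \<open>0 < s\<close> by (simp add: field_simps)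
qed

text \<open>The terms are difference quotients at 0 of t \<mapsto> \<open>x powr t\<close>, whose
  derivative there is \<open>ln x\<close>.\<close>

lemma powr_inverse_Suc_tendsto_ln:
  fixes x :: real
  assumes "x > 0"
  shows "(\<lambda>k. (x powr inverse (real (Suc k)) - 1) / inverse (real (Suc k))) \<longlonglongrightarrow> ln x"
proof -
  have "((\<lambda>t. x powr t) has_real_derivative ln x) (at 0)"
    using assms by (auto intro!: derivative_eq_intros)
  then have "((\<lambda>h. (x powr h - 1) / h) \<longlongrightarrow> ln x) (at 0)"
    using assms by (simp add: DERIV_def)
  moreover have "filterlim (\<lambda>k. inverse (real (Suc k))) (at 0) sequentially"
    by (rule filterlim_atI[OF LIMSEQ_inverse_real_of_nat]) simp
  ultimately show ?thesis by (rule filterlim_compose)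
qed

text \<open>The expectations of \<open>(f x powr s - 1) / s\<close> tend to that of
  \<open>ln (f x)\<close> along \<open>s = 1 / (k + 1)\<close>, so one of them is negative. This
  says exactly that the corresponding moment is below 1.\<close>

lemma (in prob_space) powr_moment_less_1:
  fixes f :: "'a \<Rightarrow> real"
  assumes f: "integrable M f" and inv_f: "integrable M (\<lambda>x. 1 / f x)"
    and pos: "\<And>x. x \<in> space M \<Longrightarrow> f x > 0" and ln_f: "expectation (\<lambda>x. ln (f x)) < 0"
  obtains s where "0 < s" "s \<le> 1" "integrable M (\<lambda>x. f x powr s)" "expectation (\<lambda>x. f x powr s) < 1"
proof -
  have [measurable]: "f \<in> borel_measurable M" using f by simp
  define s where "s k = inverse (real (Suc k))" for k
  have s: "0 < s k" "s k \<le> 1" for k by (auto simp: s_def field_simps)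
  let ?D = "\<lambda>k x. (f x powr s k - 1) / s k"
  \<comment> \<open>This bounds the quotients from below independently of \<open>k\<close> by an
    integrable function; the upper bound is \<open>f x - 1\<close>.\<close>
  have "1 - 1 / f x \<le> ln (f x)" if "x \<in> space M" for x
    using ln_le_minus_one[of "1 / f x"] pos[OF that] by (simp add: ln_div)
  then have bound: "norm (?D k x) \<le> 1 + 1 / f x + f x" if "x \<in> space M" for k x
    using powr_minus_one_bounds[OF pos[OF that] s, of k] pos[OF that] that
    by (smt (verit, best) divide_nonneg_pos real_norm_def)
  have dom: "integrable M (\<lambda>x. 1 + 1 / f x + f x)" using f inv_f by simp
  have lim: "(\<lambda>k. ?D k x) \<longlonglongrightarrow> ln (f x)" if "x \<in> space M" for x
    using powr_inverse_Suc_tendsto_ln[OF pos[OF that]] by (simp add: s_def)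
  have D: "integrable M (?D k)" for k
    by (rule Bochner_Integration.integrable_bound[OF dom])
      (use bound in \<open>auto intro!: AE_I2 intro: order_trans[OF _ abs_ge_self]\<close>)
  have "(\<lambda>k. expectation (?D k)) \<longlonglongrightarrow> expectation (\<lambda>x. ln (f x))"
    by (rule integral_dominated_convergence[OF _ _ dom]) (use bound lim in auto)
  then have "\<forall>\<^sub>F k in sequentially. expectation (?D k) < 0"
    using ln_f by (auto dest: order_tendstoD)
  then obtain k where k: "expectation (?D k) < 0" by (auto simp: eventually_sequentially)
  have eq: "f x powr s k = s k * ?D k x + 1" for x using s(1)[of k] by simp
  have int: "integrable M (\<lambda>x. s k * ?D k x)" using D[of k] by (rule integrable_mult_right)
  then have "integrable M (\<lambda>x. s k * ?D k x + 1)" by (rule Bochner_Integration.integrable_add) simp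
  moreover have "expectation (\<lambda>x. s k * ?D k x + 1) = s k * expectation (?D k) + 1"
    using Bochner_Integration.integral_add[OF int integrable_const[of 1]]
    by (simp only: integral_mult_right_zero) (simp add: prob_space)
  moreover have "s k * expectation (?D k) < 0" by (rule mult_pos_neg[OF s(1) k])
  ultimately show thesis
    using that[of "s k"] s[of k] by (simp flip: eq)
qed

text \<open>Integrate ln t \<le> t - 1 at \<open>t = 1 / f x\<close>, that is,
  \<open>1 - ln (f x)\<close> \<le> \<open>1 / f x\<close>.\<close>

lemma (in prob_space) expectation_inverse_gt_1:
  fixes f :: "'a \<Rightarrow> real"
  assumes inv_f: "integrable M (\<lambda>x. 1 / f x)" and ln_f: "integrable M (\<lambda>x. ln (f x))"
    and pos: "\<And>x. x \<in> space M \<Longrightarrow> f x > 0" and less: "expectation (\<lambda>x. ln (f x)) < 0"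
  shows "1 < expectation (\<lambda>x. 1 / f x)"
proof -
  have "expectation (\<lambda>x. 1 - ln (f x)) \<le> expectation (\<lambda>x. 1 / f x)"
  proof (intro integral_mono inv_f Bochner_Integration.integrable_diff ln_f)
    fix x assume "x \<in> space M"
    then have "f x > 0" by (rule pos)
    then show "1 - ln (f x) \<le> 1 / f x"
      using ln_le_minus_one[of "1 / f x"] by (simp add: ln_div)
  qed simp
  then show ?thesis using less ln_f by (simp add: prob_space)
qed

text \<open>The inequality ln t \<le> t - 1 at \<open>t = f x\<close> and at
  \<open>t = 1 / f x\<close> bounds the logarithm from both sides.\<close>

lemma (in prob_space) integrable_ln:
  fixes f :: "'a \<Rightarrow> real"
  assumes f: "integrable M f" and inv_f: "integrable M (\<lambda>x. 1 / f x)"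
    and pos: "\<And>x. x \<in> space M \<Longrightarrow> f x > 0"
  shows "integrable M (\<lambda>x. ln (f x))"
proof (rule Bochner_Integration.integrable_bound)
  show "integrable M (\<lambda>x. f x + 1 / f x)" using assms by simp
  have [measurable]: "f \<in> borel_measurable M" using f by simp
  show "(\<lambda>x. ln (f x)) \<in> borel_measurable M" by measurable
  show "AE x in M. norm (ln (f x)) \<le> norm (f x + 1 / f x)"
  proof (rule AE_I2)
    fix x assume "x \<in> space M"
    then have "f x > 0" by (rule pos)
    then show "norm (ln (f x)) \<le> norm (f x + 1 / f x)"
      using ln_le_minus_one[of "f x"] ln_le_minus_one[of "1 / f x"]
      by (smt (verit, best) divide_pos_pos ln_div ln_one real_norm_def)
  qed
qed

text \<open>Both unsigned integrals are finite here, so the extended difference is a real number.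
  This makes the sign condition on the extended integral of the logarithm one on its Bochner
  integral.\<close>

lemma expectation_eq_ext_integral:
  assumes "integrable M f"
  shows "ext_integral M f = ereal (LINT x|M. f x)"
proof -
  have fin: "(\<integral>\<^sup>+x. ennreal (f x) \<partial>M) < \<infinity>" "(\<integral>\<^sup>+x. ennreal (- f x) \<partial>M) < \<infinity>"
    using assms by (auto simp: real_integrable_def less_top)
  then obtain u v where "u \<ge> 0" "v \<ge> 0"
    "(\<integral>\<^sup>+x. ennreal (f x) \<partial>M) = ennreal u" "(\<integral>\<^sup>+x. ennreal (- f x) \<partial>M) = ennreal v"
    by (metis ennreal_cases infinity_ennreal_def less_irrefl)
  then show ?thesis
    by (simp add: ext_integral_def real_lebesgue_integral_def[OF assms])
qed

section \<open>Transition kernels as images of product measures\<close>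

text \<open>Tonelli's theorem applied to indicators. In this form one step of the chain is
  accessible to change of variables and Fubini's theorem.\<close>

lemma apply_kernel_eq_distr:
  fixes \<mu> :: "'a::topological_space measure"
  assumes \<mu>: "sets \<mu> = sets borel" and M: "prob_space M"
    and S: "(\<lambda>(x, \<theta>). S \<theta> x) \<in> borel \<Otimes>\<^sub>M M \<rightarrow>\<^sub>M borel"
  shows "apply_kernel \<mu> (trans_kernel M S) = distr (\<mu> \<Otimes>\<^sub>M M) borel (\<lambda>(x, \<theta>). S \<theta> x)"
proof (rule measure_eqI)
  interpret M: prob_space M by fact
  have S\<mu>: "(\<lambda>(x, \<theta>). S \<theta> x) \<in> \<mu> \<Otimes>\<^sub>M M \<rightarrow>\<^sub>M borel"
    using S by (simp add: measurable_cong_sets[OF sets_pair_measure_cong[OF \<mu> refl] refl])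
  show sets: "sets (apply_kernel \<mu> (trans_kernel M S)) = sets (distr (\<mu> \<Otimes>\<^sub>M M) borel (\<lambda>(x, \<theta>). S \<theta> x))"
    using sets.sigma_sets_eq[of "borel :: 'a measure"] by (simp add: apply_kernel_def)
  fix B assume "B \<in> sets (apply_kernel \<mu> (trans_kernel M S))"
  then have B [measurable]: "B \<in> sets borel" using sets by simp
  have "emeasure (distr (\<mu> \<Otimes>\<^sub>M M) borel (\<lambda>(x, \<theta>). S \<theta> x)) B =
      (\<integral>\<^sup>+z. indicator B (case z of (x, \<theta>) \<Rightarrow> S \<theta> x) \<partial>(\<mu> \<Otimes>\<^sub>M M))"
    by (subst nn_integral_distr[OF S\<mu>, symmetric]) auto
  also have "\<dots> = (\<integral>\<^sup>+x. \<integral>\<^sup>+\<theta>. indicator B (S \<theta> x) \<partial>M \<partial>\<mu>)"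
    by (subst M.nn_integral_fst[symmetric]) (auto intro: measurable_compose[OF S\<mu>])
  finally show "emeasure (apply_kernel \<mu> (trans_kernel M S)) B =
      emeasure (distr (\<mu> \<Otimes>\<^sub>M M) borel (\<lambda>(x, \<theta>). S \<theta> x)) B"
    using emeasure_apply_kernel[OF \<mu> M S B] by (simp add: trans_kernel_def)
qed

lemma apply_kernel_in_borel_probs:
  assumes \<mu>: "\<mu> \<in> borel_probs" and M: "prob_space M"
    and S: "(\<lambda>(x, \<theta>). S \<theta> x) \<in> borel \<Otimes>\<^sub>M M \<rightarrow>\<^sub>M borel"
  shows "apply_kernel \<mu> (trans_kernel M S) \<in> borel_probs"
proof -
  have \<mu>': "prob_space \<mu>" "sets \<mu> = sets borel" using \<mu> by (auto simp: borel_probs_def)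
  have "(\<lambda>(x, \<theta>). S \<theta> x) \<in> \<mu> \<Otimes>\<^sub>M M \<rightarrow>\<^sub>M borel"
    using S by (simp add: measurable_cong_sets[OF sets_pair_measure_cong[OF \<mu>'(2) refl] refl])
  then show ?thesis
    using prob_space.prob_space_distr[OF prob_space_pair[OF \<mu>'(1) M]]
    by (simp add: borel_probs_def apply_kernel_eq_distr[OF \<mu>'(2) M S])
qed

lemma chain_law_in_borel_probs:
  assumes "\<mu> \<in> borel_probs" and "\<And>n. n \<ge> 1 \<Longrightarrow> prob_space (M n)"
    and "\<And>n. n \<ge> 1 \<Longrightarrow> (\<lambda>(x, \<theta>). S n \<theta> x) \<in> borel \<Otimes>\<^sub>M M n \<rightarrow>\<^sub>M borel"
  shows "chain_law M S \<mu> n \<in> borel_probs"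
  by (induction n) (simp_all add: assms apply_kernel_in_borel_probs)

text \<open>Fubini's theorem on the product space; boundedness of \<open>f\<close> gives
  integrability under every initial law. The first claim is what monotonicity of the outer integral
  asks for later.\<close>

lemma integral_apply_kernel:
  fixes f :: "'a::topological_space \<Rightarrow> real"
  assumes \<mu>: "\<mu> \<in> borel_probs" and M: "prob_space M"
    and S: "(\<lambda>(x, \<theta>). S \<theta> x) \<in> borel \<Otimes>\<^sub>M M \<rightarrow>\<^sub>M borel"
    and f [measurable]: "f \<in> borel_measurable borel" and bound: "\<And>x. \<bar>f x\<bar> \<le> B"
  shows "integrable \<mu> (\<lambda>x. LINT \<theta>|M. f (S \<theta> x))"
    and "(LINT x|apply_kernel \<mu> (trans_kernel M S). f x) = (LINT x|\<mu>. LINT \<theta>|M. f (S \<theta> x))"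
proof -
  have \<mu>': "prob_space \<mu>" "sets \<mu> = sets borel" using \<mu> by (auto simp: borel_probs_def)
  interpret pair_prob_space \<mu> M
    using \<mu>'(1) M by (simp add: pair_prob_space_def pair_sigma_finite_def prob_space_imp_sigma_finite)
  have S\<mu>: "(\<lambda>(x, \<theta>). S \<theta> x) \<in> \<mu> \<Otimes>\<^sub>M M \<rightarrow>\<^sub>M borel"
    using S by (simp add: measurable_cong_sets[OF sets_pair_measure_cong[OF \<mu>'(2) refl] refl])
  have "integrable (\<mu> \<Otimes>\<^sub>M M) (\<lambda>z. f (case z of (x, \<theta>) \<Rightarrow> S \<theta> x))"
    by (rule P.integrable_const_bound[where B = B])
      (use bound in \<open>auto intro: measurable_compose[OF S\<mu>]\<close>)
  then have int: "integrable (\<mu> \<Otimes>\<^sub>M M) (\<lambda>(x, \<theta>). f (S \<theta> x))" by (simp add: split_def)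
  show "integrable \<mu> (\<lambda>x. LINT \<theta>|M. f (S \<theta> x))"
    using integrable_fst[OF int] by simp
  have "(LINT x|apply_kernel \<mu> (trans_kernel M S). f x) = (LINT (x, \<theta>)|(\<mu> \<Otimes>\<^sub>M M). f (S \<theta> x))"
    unfolding apply_kernel_eq_distr[OF \<mu>'(2) M S]
    by (subst integral_distr[OF S\<mu>]) (auto simp: split_def)
  also have "\<dots> = (LINT x|\<mu>. LINT \<theta>|M. f (S \<theta> x))"
    using integral_fst[OF int] by simp
  finally show "(LINT x|apply_kernel \<mu> (trans_kernel M S). f x) = (LINT x|\<mu>. LINT \<theta>|M. f (S \<theta> x))" .
qed

section \<open>Truncated fractional moments along the chain\<close>

text \<open>Divide by \<open>x + y\<close>: the two fractions lie in [0, 1], where t \<le>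
  \<open>t powr s\<close>, and they sum to 1.\<close>

lemma powr_add_le:
  fixes x y s :: real
  assumes "x \<ge> 0" "y \<ge> 0" "s \<le> 1"
  shows "(x + y) powr s \<le> x powr s + y powr s"
proof (cases "x + y = 0")
  case False
  then have pos: "x + y > 0" using assms by simp
  have "x / (x + y) \<le> (x / (x + y)) powr s" "y / (x + y) \<le> (y / (x + y)) powr s"
    using powr_mono'[of s 1 "x / (x + y)"] powr_mono'[of s 1 "y / (x + y)"] assms pos by simp_all
  then have "x / (x + y) + y / (x + y) \<le> (x powr s + y powr s) / (x + y) powr s"
    by (simp add: powr_divide add_divide_distrib)
  then show ?thesis using pos by (simp add: field_simps flip: add_divide_distrib)
qed (use assms in simp)

lemma integrable_min_1:
  fixes f :: "'a \<Rightarrow> real"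
  assumes "prob_space M" "f \<in> borel_measurable M" "\<And>x. 0 \<le> f x"
  shows "integrable M (\<lambda>x. min 1 (f x))"
proof -
  interpret prob_space M by fact
  show ?thesis by (rule integrable_const_bound[where B = 1]) (use assms in auto)
qed

text \<open>The norm of the image is at most \<open>l \<theta> * norm x + norm (b \<theta>)\<close>,
  and subadditivity of the power separates the two terms. The result has the form of the integrand
  again, with \<open>c + d * g\<close> and \<open>d * r\<close> for \<open>c\<close> and
  \<open>d\<close>.\<close>

lemma expectation_min_powr_affine_le:
  fixes A :: "'t \<Rightarrow> 'a \<Rightarrow> 'a::{real_normed_vector, second_countable_topology}"
  assumes M: "prob_space M" and s: "0 < s" "s \<le> 1"
    and [measurable]: "(\<lambda>\<theta>. A \<theta> x) \<in> borel_measurable M" "b \<in> borel_measurable M"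
    and A: "\<And>\<theta>. \<theta> \<in> space M \<Longrightarrow> norm (A \<theta> x) \<le> l \<theta> * norm x"
    and l: "\<And>\<theta>. \<theta> \<in> space M \<Longrightarrow> 0 \<le> l \<theta>"
    and l_int: "integrable M (\<lambda>\<theta>. l \<theta> powr s)" and r: "(LINT \<theta>|M. l \<theta> powr s) \<le> r"
    and b_int: "integrable M (\<lambda>\<theta>. norm (b \<theta>) powr s)" and g: "(LINT \<theta>|M. norm (b \<theta>) powr s) \<le> g"
    and cd: "0 \<le> c" "0 \<le> d"
  shows "(LINT \<theta>|M. min 1 (c + d * norm (A \<theta> x + b \<theta>) powr s))
    \<le> min 1 (c + d * g + d * r * norm x powr s)"
proof (rule min.boundedI)
  interpret prob_space M by fact
  have int: "integrable M (\<lambda>\<theta>. min 1 (c + d * norm (A \<theta> x + b \<theta>) powr s))"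
  proof (rule integrable_min_1[OF M])
    show "(\<lambda>\<theta>. c + d * norm (A \<theta> x + b \<theta>) powr s) \<in> borel_measurable M" by measurable
  qed (use cd in simp)
  show "(LINT \<theta>|M. min 1 (c + d * norm (A \<theta> x + b \<theta>) powr s)) \<le> 1"
    using integral_mono[OF int integrable_const[of 1]] by (simp add: prob_space)
  let ?u = "\<lambda>\<theta>. c + d * norm (b \<theta>) powr s + d * norm x powr s * l \<theta> powr s"
  have "(LINT \<theta>|M. min 1 (c + d * norm (A \<theta> x + b \<theta>) powr s)) \<le> (LINT \<theta>|M. ?u \<theta>)"
  proof (rule integral_mono[OF int])
    show "integrable M ?u" using l_int b_int by simp
    fix \<theta> assume \<theta>: "\<theta> \<in> space M"
    have "norm (A \<theta> x + b \<theta>) \<le> l \<theta> * norm x + norm (b \<theta>)"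
      using norm_triangle_ineq[of "A \<theta> x" "b \<theta>"] A[OF \<theta>] by linarith
    then have "norm (A \<theta> x + b \<theta>) powr s \<le> (l \<theta> * norm x + norm (b \<theta>)) powr s"
      using s by (intro powr_mono2) auto
    also have "\<dots> \<le> (l \<theta> * norm x) powr s + norm (b \<theta>) powr s"
      using s l[OF \<theta>] by (intro powr_add_le) auto
    also have "\<dots> = norm (b \<theta>) powr s + norm x powr s * l \<theta> powr s" by (simp add: powr_mult)
    finally have "d * norm (A \<theta> x + b \<theta>) powr s \<le> d * (norm (b \<theta>) powr s + norm x powr s * l \<theta> powr s)"
      using cd by (intro mult_left_mono)
    then show "min 1 (c + d * norm (A \<theta> x + b \<theta>) powr s) \<le> ?u \<theta>" by (simp add: algebra_simps)
  qed
  also have "\<dots> = c + d * (LINT \<theta>|M. norm (b \<theta>) powr s) + d * norm x powr s * (LINT \<theta>|M. l \<theta> powr s)"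
    using l_int b_int by (simp add: prob_space)
  also have "\<dots> \<le> c + d * g + d * norm x powr s * r"
    using r g cd by (intro add_mono mult_left_mono) auto
  finally show "(LINT \<theta>|M. min 1 (c + d * norm (A \<theta> x + b \<theta>) powr s))
      \<le> c + d * g + d * r * norm x powr s" by (simp add: mult_ac)
qed

text \<open>
  Truncating at \<open>1\<close> keeps the integrals finite for every initial law; the constants \<open>c\<close> and \<open>d\<close> make
  the class of integrands stable under the transition operators.
\<close>

lemma expectation_min_powr_chain_law_le:
  fixes A :: "nat \<Rightarrow> 't \<Rightarrow> 'a \<Rightarrow> 'a::{real_normed_vector, second_countable_topology}"
  assumes M: "\<And>n. n \<ge> 1 \<Longrightarrow> prob_space (M n)" and s: "0 < s" "s \<le> 1"
    and A_meas: "\<And>n. n \<ge> 1 \<Longrightarrow> (\<lambda>(x, \<theta>). A n \<theta> x) \<in> borel \<Otimes>\<^sub>M M n \<rightarrow>\<^sub>M borel"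
    and b_meas: "\<And>n. n \<ge> 1 \<Longrightarrow> b n \<in> borel_measurable (M n)"
    and A: "\<And>n \<theta> x. n \<ge> 1 \<Longrightarrow> \<theta> \<in> space (M n) \<Longrightarrow> norm (A n \<theta> x) \<le> l n \<theta> * norm x"
    and l: "\<And>n \<theta>. n \<ge> 1 \<Longrightarrow> \<theta> \<in> space (M n) \<Longrightarrow> 0 \<le> l n \<theta>"
    and l_int: "\<And>n. n \<ge> 1 \<Longrightarrow> integrable (M n) (\<lambda>\<theta>. l n \<theta> powr s)"
    and r: "\<And>n. n \<ge> 1 \<Longrightarrow> (LINT \<theta>|M n. l n \<theta> powr s) \<le> r"
    and b_int: "\<And>n. n \<ge> 1 \<Longrightarrow> integrable (M n) (\<lambda>\<theta>. norm (b n \<theta>) powr s)"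
    and e: "\<And>n. (LINT \<theta>|M (Suc n). norm (b (Suc n) \<theta>) powr s) + r * e n \<le> e (Suc n)" "e 0 \<ge> 0"
    and S: "\<And>n \<theta> x. S n \<theta> x = A n \<theta> x + b n \<theta>"
    and \<mu>: "\<mu> \<in> borel_probs" and cd: "0 \<le> c" "0 \<le> d"
  shows "(LINT x|chain_law M S \<mu> n. min 1 (c + d * norm x powr s))
    \<le> (LINT x|\<mu>. min 1 (c + d * e n + d * r ^ n * norm x powr s))"
proof -
  have r0: "r \<ge> 0" by (rule order_trans[OF _ r[of 1]]) auto
  \<comment> \<open>\<open>e\<close> dominates the accumulated contribution of the translations. Its
    nonnegativity keeps the truncated integrands nonnegative, hence integrable.\<close>
  have e0: "e n \<ge> 0" for n
  proof (induction n)
    case (Suc n)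
    with r0 have "0 \<le> (LINT \<theta>|M (Suc n). norm (b (Suc n) \<theta>) powr s) + r * e n" by simp
    then show ?case using e(1)[of n] by linarith
  qed (use e in simp)
  have S_meas: "(\<lambda>(x, \<theta>). S n \<theta> x) \<in> borel \<Otimes>\<^sub>M M n \<rightarrow>\<^sub>M borel" if n: "n \<ge> 1" for n
  proof -
    note [measurable] = A_meas[OF n, unfolded split_def] b_meas[OF n]
    show ?thesis unfolding S split_def by measurable
  qed
  have chain: "chain_law M S \<mu> n \<in> borel_probs" for n
    by (rule chain_law_in_borel_probs[OF \<mu> M S_meas])
  show ?thesis
    using cd
  \<comment> \<open>The last transition is integrated out first, which changes the constants; the
    hypothesis for the first \<open>n\<close> steps is then used with the new ones.\<close>
  proof (induction n arbitrary: c d)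
    case 0
    interpret prob_space \<mu> using \<mu> by (simp add: borel_probs_def)
    have [measurable]: "norm \<in> borel_measurable \<mu>"
      using \<mu> by (auto simp: borel_probs_def cong: measurable_cong_sets)
    show ?case
      using 0 e(2) by (auto intro!: integral_mono integrable_min_1 prob_space_axioms min.mono)
  next
    case (Suc n)
    interpret P: prob_space "chain_law M S \<mu> n" using chain[of n] by (simp add: borel_probs_def)
    have [measurable]: "norm \<in> borel_measurable (chain_law M S \<mu> n)"
      using chain[of n] by (auto simp: borel_probs_def cong: measurable_cong_sets)
    interpret Q: prob_space \<mu> using \<mu> by (simp add: borel_probs_def)
    have [measurable]: "norm \<in> borel_measurable \<mu>"
      using \<mu> by (auto simp: borel_probs_def cong: measurable_cong_sets)
    let ?g = "LINT \<theta>|M (Suc n). norm (b (Suc n) \<theta>) powr s"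
    have g0: "?g \<ge> 0" by simp
    have Sn: "(\<lambda>(x, \<theta>). S (Suc n) \<theta> x) \<in> borel \<Otimes>\<^sub>M M (Suc n) \<rightarrow>\<^sub>M borel" by (rule S_meas) simp
    have Mn: "prob_space (M (Suc n))" by (rule M) simp
    have A_x: "(\<lambda>\<theta>. A (Suc n) \<theta> x) \<in> borel_measurable (M (Suc n))" for x
      using measurable_compose[OF measurable_Pair1'[of x borel "M (Suc n)"] A_meas[of "Suc n"]] by simp
    note fub = integral_apply_kernel[OF chain[of n] Mn Sn, where B = 1,
        of "\<lambda>x. min 1 (c + d * norm x powr s)"]
    have "(LINT x|chain_law M S \<mu> (Suc n). min 1 (c + d * norm x powr s)) =
        (LINT x|chain_law M S \<mu> n. LINT \<theta>|M (Suc n). min 1 (c + d * norm (S (Suc n) \<theta> x) powr s))"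
      using Suc.prems by (simp, intro fub(2)) auto
    also have "\<dots> \<le> (LINT x|chain_law M S \<mu> n. min 1 (c + d * ?g + d * r * norm x powr s))"
    proof (rule integral_mono)
      show "integrable (chain_law M S \<mu> n) (\<lambda>x. LINT \<theta>|M (Suc n). min 1 (c + d * norm (S (Suc n) \<theta> x) powr s))"
        using Suc.prems by (intro fub(1)) auto
      show "integrable (chain_law M S \<mu> n) (\<lambda>x. min 1 (c + d * ?g + d * r * norm x powr s))"
        using Suc.prems r0 g0 by (intro integrable_min_1[OF P.prob_space_axioms]) auto
      show "(LINT \<theta>|M (Suc n). min 1 (c + d * norm (S (Suc n) \<theta> x) powr s))
          \<le> min 1 (c + d * ?g + d * r * norm x powr s)" for x
        unfolding S
        by (rule expectation_min_powr_affine_le[OF Mn s A_x b_meas A l l_int r b_int _ Suc.prems]) auto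
    qed
    also have "\<dots> \<le> (LINT x|\<mu>. min 1 ((c + d * ?g) + (d * r) * e n + (d * r) * r ^ n * norm x powr s))"
      using Suc.prems r0 g0 by (intro Suc.IH) auto
    also have "\<dots> \<le> (LINT x|\<mu>. min 1 (c + d * e (Suc n) + d * r ^ Suc n * norm x powr s))"
    proof (rule integral_mono)
      fix x :: 'a
      \<comment> \<open>The recursive inequality for \<open>e\<close> absorbs the newest translation
        together with the contracted earlier ones.\<close>
      have "d * (?g + r * e n) \<le> d * e (Suc n)" using e(1) Suc.prems by (intro mult_left_mono)
      then show "min 1 ((c + d * ?g) + (d * r) * e n + (d * r) * r ^ n * norm x powr s)
          \<le> min 1 (c + d * e (Suc n) + d * r ^ Suc n * norm x powr s)"
        by (intro min.mono) (auto simp: algebra_simps)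
    qed (use Suc.prems r0 g0 e0 in \<open>auto intro!: integrable_min_1 Q.prob_space_axioms\<close>)
    finally show ?case .
  qed
qed

section \<open>Truncated moments control the distance to the Dirac measure at 0\<close>

lemma return_in_borel_probs: "return borel x \<in> borel_probs"
  by (simp add: borel_probs_def prob_space_return)

text \<open>Integration against the Dirac measure gives \<open>f 0\<close>. In the unit ball the
  Lipschitz bound and \<open>norm x\<close> \<le> \<open>norm x powr s\<close> control the
  difference \<open>f x - f 0\<close>; outside it is at most 2.\<close>

lemma dist_BL_return_0_le:
  fixes \<nu> :: "'a::{real_normed_vector, second_countable_topology} measure"
  assumes \<nu>: "\<nu> \<in> borel_probs" and s: "0 < s" "s \<le> 1"
  shows "dist_BL \<nu> (return borel 0) \<le> 2 * (LINT x|\<nu>. min 1 (norm x powr s))"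
  unfolding dist_BL_def
proof (rule cSUP_least)
  \<comment> \<open>Bounding a real supremum by a common upper bound requires a nonempty
    family.\<close>
  have "(\<lambda>_. 0) \<in> {f :: 'a \<Rightarrow> real. (\<forall>x. f x \<in> {-1..1}) \<and> 1-lipschitz_on UNIV f}"
    by (simp add: lipschitz_on_def)
  then show "{f :: 'a \<Rightarrow> real. (\<forall>x. f x \<in> {-1..1}) \<and> 1-lipschitz_on UNIV f} \<noteq> {}" by (metis empty_iff)
  fix f :: "'a \<Rightarrow> real"
  assume f: "f \<in> {f. (\<forall>x. f x \<in> {-1..1}) \<and> 1-lipschitz_on UNIV f}"
  then have lip: "1-lipschitz_on UNIV f" and bound: "-1 \<le> f x" "f x \<le> 1" for x by auto
  interpret prob_space \<nu> using \<nu> by (simp add: borel_probs_def)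
  have sets: "sets \<nu> = sets borel" using \<nu> by (simp add: borel_probs_def)
  have f_meas: "f \<in> borel_measurable borel"
    by (intro borel_measurable_continuous_onI lipschitz_on_continuous_on[OF lip])
  have f_int: "integrable \<nu> f"
    by (rule integrable_const_bound[where B = 1])
      (use bound f_meas sets in \<open>auto simp: abs_le_iff minus_le_iff cong: measurable_cong_sets\<close>)
  have min_int: "integrable \<nu> (\<lambda>x. min 1 (norm x powr s))"
    by (rule integrable_min_1[OF prob_space_axioms]) (use sets in \<open>auto cong: measurable_cong_sets\<close>)
  have le: "\<bar>f x - f 0\<bar> \<le> 2 * min 1 (norm x powr s)" for x
  proof (cases "norm x \<le> 1")
    case True
    have "\<bar>f x - f 0\<bar> \<le> norm x"
      using lipschitz_onD[OF lip, of x 0] by (simp add: dist_norm)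
    also have "\<dots> \<le> norm x powr s" using powr_mono'[of s 1 "norm x"] s True by simp
    finally show ?thesis using powr_le1[of s "norm x"] s True by simp
  next
    case False
    then have "1 \<le> norm x powr s" using s by (intro ge_one_powr_ge_zero) auto
    then show ?thesis using bound[of x] bound[of 0] by simp
  qed
  have "\<bar>(LINT x|\<nu>. f x) - (LINT x|return borel 0. f x)\<bar> = \<bar>LINT x|\<nu>. f x - f 0\<bar>"
    using f_int by (simp add: integral_return f_meas prob_space)
  also have "\<dots> \<le> (LINT x|\<nu>. \<bar>f x - f 0\<bar>)" by (rule integral_abs_bound)
  also have "\<dots> \<le> (LINT x|\<nu>. 2 * min 1 (norm x powr s))"
    using f_int min_int le by (intro integral_mono) auto
  also have "\<dots> = 2 * (LINT x|\<nu>. min 1 (norm x powr s))" by simp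
  finally show "\<bar>(LINT x|\<nu>. f x) - (LINT x|return borel 0. f x)\<bar> \<le> 2 * (LINT x|\<nu>. min 1 (norm x powr s))" .
qed

text \<open>Continuity at 0 handles a small ball. Outside it a Markov-type estimate bounds the mass
  by the truncated moment divided by a power of the radius.\<close>

lemma weakly_converges_return_0:
  fixes \<nu> :: "nat \<Rightarrow> 'a::{real_normed_vector, second_countable_topology} measure"
  assumes \<nu>: "\<And>n. \<nu> n \<in> borel_probs" and s: "0 < s"
    and lim: "(\<lambda>n. LINT x|\<nu> n. min 1 (norm x powr s)) \<longlonglongrightarrow> 0"
  shows "weakly_converges \<nu> (return borel 0)"
  unfolding weakly_converges_def
proof (intro allI impI)
  fix f :: "'a \<Rightarrow> real"
  assume "continuous_on UNIV f \<and> bounded (range f)"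
  then have cont: "continuous_on UNIV f" and "bounded (range f)" by auto
  then obtain B where B: "\<And>x. \<bar>f x\<bar> \<le> B" by (auto simp: bounded_iff)
  have "B \<ge> 0" using B[of 0] by linarith
  have f_meas: "f \<in> borel_measurable borel" by (rule borel_measurable_continuous_onI[OF cont])
  have close: "\<bar>(LINT x|\<nu> n. f x) - f 0\<bar> \<le> \<epsilon> + 2 * B / \<eta> powr s * (LINT x|\<nu> n. min 1 (norm x powr s))"
    if \<eta>: "0 < \<eta>" "\<eta> \<le> 1" and near: "\<And>x. norm x < \<eta> \<Longrightarrow> \<bar>f x - f 0\<bar> \<le> \<epsilon>" for \<epsilon> \<eta> n
  proof -
    interpret prob_space "\<nu> n" using \<nu> by (simp add: borel_probs_def)
    have sets: "sets (\<nu> n) = sets borel" using \<nu> by (simp add: borel_probs_def)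
    have f_int: "integrable (\<nu> n) f"
      by (rule integrable_const_bound[where B = B])
        (use B f_meas sets in \<open>auto cong: measurable_cong_sets\<close>)
    have min_int: "integrable (\<nu> n) (\<lambda>x. min 1 (norm x powr s))"
      by (rule integrable_min_1[OF prob_space_axioms]) (use sets in \<open>auto cong: measurable_cong_sets\<close>)
    have "\<epsilon> \<ge> 0" using near[of 0] \<eta> by simp
    have le: "\<bar>f x - f 0\<bar> \<le> \<epsilon> + 2 * B / \<eta> powr s * min 1 (norm x powr s)" for x
    proof (cases "norm x < \<eta>")
      case True
      then show ?thesis using near[of x] \<open>B \<ge> 0\<close> by (simp add: add_increasing2)
    next
      case False
      then have "\<eta> powr s \<le> min 1 (norm x powr s)"
        using \<eta> s by (auto intro: powr_mono2 powr_le1)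
      then have "2 * B / \<eta> powr s * \<eta> powr s \<le> 2 * B / \<eta> powr s * min 1 (norm x powr s)"
        using \<open>B \<ge> 0\<close> by (intro mult_left_mono) auto
      moreover have "\<bar>f x - f 0\<bar> \<le> 2 * B" using B[of x] B[of 0] by linarith
      ultimately show ?thesis using \<eta> \<open>\<epsilon> \<ge> 0\<close> by simp
    qed
    have "\<bar>(LINT x|\<nu> n. f x) - f 0\<bar> = \<bar>LINT x|\<nu> n. f x - f 0\<bar>"
      using f_int by (simp add: prob_space)
    also have "\<dots> \<le> (LINT x|\<nu> n. \<bar>f x - f 0\<bar>)" by (rule integral_abs_bound)
    also have "\<dots> \<le> (LINT x|\<nu> n. \<epsilon> + 2 * B / \<eta> powr s * min 1 (norm x powr s))"
      by (intro integral_mono le Bochner_Integration.integrable_add integrable_mult_right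
          integrable_abs Bochner_Integration.integrable_diff f_int min_int) auto
    also have "\<dots> = \<epsilon> + 2 * B / \<eta> powr s * (LINT x|\<nu> n. min 1 (norm x powr s))"
      by (subst Bochner_Integration.integral_add) (use min_int in \<open>auto simp: prob_space\<close>)
    finally show ?thesis .
  qed
  have "(\<lambda>n. LINT x|\<nu> n. f x) \<longlonglongrightarrow> f 0"
  proof (rule LIMSEQ_I)
    fix \<epsilon> :: real assume "\<epsilon> > 0"
    have "isCont f 0" using cont by (simp add: continuous_on_eq_continuous_at)
    then have "\<exists>\<eta>>0. \<forall>x. dist x 0 < \<eta> \<longrightarrow> dist (f x) (f 0) < \<epsilon> / 2"
      using half_gt_zero[OF \<open>\<epsilon> > 0\<close>] unfolding continuous_at_eps_delta by blast
    then obtain \<eta> where "\<eta> > 0" and \<eta>: "\<And>x. norm x < \<eta> \<Longrightarrow> \<bar>f x - f 0\<bar> < \<epsilon> / 2"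
      by (auto simp: dist_real_def)
    \<comment> \<open>With the radius capped at 1 its power is at most 1, hence a lower bound for
      the truncated integrand outside the ball.\<close>
    define \<eta>' where "\<eta>' = min 1 \<eta>"
    have \<eta>': "0 < \<eta>'" "\<eta>' \<le> 1" using \<open>\<eta> > 0\<close> by (auto simp: \<eta>'_def)
    have near: "\<bar>f x - f 0\<bar> \<le> \<epsilon> / 2" if "norm x < \<eta>'" for x
      using \<eta>[of x] that by (simp add: \<eta>'_def)
    have "(\<lambda>n. \<epsilon> / 2 + 2 * B / \<eta>' powr s * (LINT x|\<nu> n. min 1 (norm x powr s))) \<longlonglongrightarrow> \<epsilon> / 2 + 2 * B / \<eta>' powr s * 0"
      by (intro tendsto_intros lim)
    then have "\<forall>\<^sub>F n in sequentially. \<epsilon> / 2 + 2 * B / \<eta>' powr s * (LINT x|\<nu> n. min 1 (norm x powr s)) < \<epsilon>"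
      by (rule order_tendstoD) (use \<open>\<epsilon> > 0\<close> in simp)
    then obtain N where N: "\<And>n. n \<ge> N \<Longrightarrow> \<epsilon> / 2 + 2 * B / \<eta>' powr s * (LINT x|\<nu> n. min 1 (norm x powr s)) < \<epsilon>"
      by (auto simp: eventually_sequentially)
    then show "\<exists>N. \<forall>n\<ge>N. norm ((LINT x|\<nu> n. f x) - f 0) < \<epsilon>"
      using le_less_trans[OF close[OF \<eta>' near] N] by auto
  qed
  then show "(\<lambda>n. LINT x|\<nu> n. f x) \<longlonglongrightarrow> (LINT x|return borel 0. f x)"
    by (simp add: integral_return f_meas)
qed

section \<open>Exponential convergence from a contracting fractional moment\<close>

lemma powr_le_one_add:
  fixes x s :: real
  assumes "0 \<le> x" "0 < s" "s \<le> 1"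
  shows "x powr s \<le> 1 + x"
proof (cases "x \<le> 1")
  case True
  then have "x powr s \<le> 1" using assms by (simp add: powr_le1)
  then show ?thesis using assms by simp
next
  case False
  then show ?thesis using powr_mono[of s 1 x] assms by simp
qed

text \<open>Integrate \<open>t powr s\<close> \<le> \<open>1 + t\<close> at
  \<open>t = f x / c\<close>. The scaling preserves the homogeneous bound \<open>c powr s\<close> up
  to a factor 2, so geometric decay of means passes to fractional moments. A positive upper bound
  \<open>c\<close> permits the division even if the mean vanishes.\<close>

lemma (in prob_space) expectation_powr_le:
  fixes f :: "'a \<Rightarrow> real"
  assumes f: "integrable M f" "\<And>x. x \<in> space M \<Longrightarrow> 0 \<le> f x" and s: "0 < s" "s \<le> 1"
    and c: "0 < c" "expectation f \<le> c"
  shows "integrable M (\<lambda>x. f x powr s)" and "expectation (\<lambda>x. f x powr s) \<le> 2 * c powr s"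
proof -
  have le: "f x powr s \<le> c powr s * (1 + f x / c)" if "x \<in> space M" for x
  proof -
    have "(f x / c) powr s \<le> 1 + f x / c" using f(2)[OF that] s c by (intro powr_le_one_add) auto
    then have "c powr s * (f x / c) powr s \<le> c powr s * (1 + f x / c)" by (intro mult_left_mono) auto
    then show ?thesis using c by (simp add: powr_divide)
  qed
  have int: "integrable M (\<lambda>x. c powr s * (1 + f x / c))" using f(1) by simp
  show int': "integrable M (\<lambda>x. f x powr s)"
    by (rule Bochner_Integration.integrable_bound[OF int])
      (use f(1) le in \<open>auto intro!: AE_I2 intro: order_trans[OF _ abs_ge_self]\<close>)
  have "expectation (\<lambda>x. f x powr s) \<le> expectation (\<lambda>x. c powr s * (1 + f x / c))"
    by (rule integral_mono[OF int' int le])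
  also have "\<dots> = c powr s * (1 + expectation f / c)" using f(1) by (simp add: prob_space)
  also have "\<dots> \<le> c powr s * 2" using c by (intro mult_left_mono) auto
  finally show "expectation (\<lambda>x. f x powr s) \<le> 2 * c powr s" by simp
qed

text \<open>The moments contract by \<open>r\<close> and receive a perturbation of order
  \<open>p ^ n\<close>, hence decay at any rate \<open>q\<close> < 1 with \<open>q\<close> >
  \<open>r\<close> and \<open>q\<close> \<ge> \<open>p\<close>.\<close>

theorem affine_chain_law_converges_to_return_0:
  fixes A :: "nat \<Rightarrow> 't \<Rightarrow> 'a \<Rightarrow> 'a::{real_normed_vector, second_countable_topology}"
  assumes M: "\<And>n. n \<ge> 1 \<Longrightarrow> prob_space (M n)" and s: "0 < s" "s \<le> 1"
    and A_meas: "\<And>n. n \<ge> 1 \<Longrightarrow> (\<lambda>(x, \<theta>). A n \<theta> x) \<in> borel \<Otimes>\<^sub>M M n \<rightarrow>\<^sub>M borel"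
    and b_meas: "\<And>n. n \<ge> 1 \<Longrightarrow> b n \<in> borel_measurable (M n)"
    and A: "\<And>n \<theta> x. n \<ge> 1 \<Longrightarrow> \<theta> \<in> space (M n) \<Longrightarrow> norm (A n \<theta> x) \<le> l n \<theta> * norm x"
    and l: "\<And>n \<theta>. n \<ge> 1 \<Longrightarrow> \<theta> \<in> space (M n) \<Longrightarrow> 0 \<le> l n \<theta>"
    and l_int: "\<And>n. n \<ge> 1 \<Longrightarrow> integrable (M n) (\<lambda>\<theta>. l n \<theta> powr s)"
    and r: "\<And>n. n \<ge> 1 \<Longrightarrow> (LINT \<theta>|M n. l n \<theta> powr s) \<le> r" "r < 1"
    and b_int: "\<And>n. n \<ge> 1 \<Longrightarrow> integrable (M n) (\<lambda>\<theta>. norm (b n \<theta>) powr s)"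
    and b_le: "\<And>n. n \<ge> 1 \<Longrightarrow> (LINT \<theta>|M n. norm (b n \<theta>) powr s) \<le> G * p ^ n" "0 \<le> p" "p < 1"
    and S: "\<And>n \<theta> x. S n \<theta> x = A n \<theta> x + b n \<theta>"
  shows "\<exists>q \<in> {0<..<1}. \<exists>C \<ge> 0. \<forall>\<mu> \<in> borel_probs_fm. \<forall>n.
      dist_BL (chain_law M S \<mu> n) (return borel 0) \<le> C * q ^ n * (1 + (LINT x|\<mu>. norm x))"
    and "\<mu> \<in> borel_probs \<Longrightarrow> weakly_converges (chain_law M S \<mu>) (return borel 0)"
proof -
  have r0: "r \<ge> 0" by (rule order_trans[OF _ r(1)[of 1]]) auto
  \<comment> \<open>The midpoint between \<open>max r p\<close> and 1 lies strictly above
    \<open>r\<close> and is positive even if \<open>r\<close> and \<open>p\<close> vanish.\<close>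
  define q where "q = (max r p + 1) / 2"
  have q: "0 < q" "q < 1" "r < q" "p \<le> q" using r0 r(2) b_le by (auto simp: q_def max_def)
  \<comment> \<open>\<open>H\<close> solves \<open>H * (q - r) = \<bar>G\<bar> * q\<close>, which
    makes \<open>H * q ^ n\<close> satisfy the recursive inequality required of
    \<open>e\<close>.\<close>
  define H where "H = \<bar>G\<bar> * q / (q - r)"
  have H: "H * (q - r) = \<bar>G\<bar> * q" using q by (simp add: H_def)
  have H0: "H \<ge> 0" using q by (simp add: H_def)
  have step: "(LINT \<theta>|M (Suc n). norm (b (Suc n) \<theta>) powr s) + r * (H * q ^ n) \<le> H * q ^ Suc n" for n
  proof -
    have "(LINT \<theta>|M (Suc n). norm (b (Suc n) \<theta>) powr s) \<le> G * p ^ Suc n" by (rule b_le) simp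
    also have "\<dots> \<le> \<bar>G\<bar> * q ^ Suc n" using b_le q by (intro mult_mono power_mono) auto
    also have "\<dots> = H * (q - r) * q ^ n" by (simp add: H)
    also have "\<dots> = H * q ^ Suc n - r * (H * q ^ n)" by (simp add: algebra_simps)
    finally show ?thesis by simp
  qed
  have S_meas: "(\<lambda>(x, \<theta>). S n \<theta> x) \<in> borel \<Otimes>\<^sub>M M n \<rightarrow>\<^sub>M borel" if n: "n \<ge> 1" for n
  proof -
    note [measurable] = A_meas[OF n, unfolded split_def] b_meas[OF n]
    show ?thesis unfolding S split_def by measurable
  qed
  have chain: "chain_law M S \<mu> n \<in> borel_probs" if "\<mu> \<in> borel_probs" for \<mu> n
    by (rule chain_law_in_borel_probs[OF that M S_meas])
  have moment: "(LINT x|chain_law M S \<mu> n. min 1 (norm x powr s))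
      \<le> (LINT x|\<mu>. min 1 (H * q ^ n + r ^ n * norm x powr s))" if "\<mu> \<in> borel_probs" for \<mu> n
    using expectation_min_powr_chain_law_le[where M = M and A = A and b = b and l = l and S = S
        and e = "\<lambda>n. H * q ^ n" and c = 0 and d = 1 and n = n,
        OF M s A_meas b_meas A l l_int r(1) b_int step _ S that] H0 by simp
  show "\<exists>q \<in> {0<..<1}. \<exists>C \<ge> 0. \<forall>\<mu> \<in> borel_probs_fm. \<forall>n.
      dist_BL (chain_law M S \<mu> n) (return borel 0) \<le> C * q ^ n * (1 + (LINT x|\<mu>. norm x))"
  \<comment> \<open>In the constant, 2 comes from the bounded Lipschitz estimate, \<open>H\<close>
    from the translations and 1 from the initial law.\<close>
  proof (intro bexI[of _ q] exI[of _ "2 * (H + 1)"] conjI ballI allI)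
    fix \<mu> :: "'a measure" and n
    assume "\<mu> \<in> borel_probs_fm"
    then have \<mu>: "\<mu> \<in> borel_probs" and norm_int: "integrable \<mu> norm" by (auto simp: borel_probs_fm_def)
    interpret prob_space \<mu> using \<mu> by (simp add: borel_probs_def)
    have [measurable]: "norm \<in> borel_measurable \<mu>" using norm_int by simp
    have I: "(LINT x|\<mu>. norm x) \<ge> 0" by simp
    have "dist_BL (chain_law M S \<mu> n) (return borel 0)
        \<le> 2 * (LINT x|\<mu>. min 1 (H * q ^ n + r ^ n * norm x powr s))"
      using dist_BL_return_0_le[OF chain[OF \<mu>] s, of n] moment[OF \<mu>, of n] by linarith
    also have "(LINT x|\<mu>. min 1 (H * q ^ n + r ^ n * norm x powr s))
        \<le> (LINT x|\<mu>. H * q ^ n + q ^ n * (1 + norm x))"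
    proof (rule integral_mono)
      show "integrable \<mu> (\<lambda>x. min 1 (H * q ^ n + r ^ n * norm x powr s))"
        using H0 q r0 by (intro integrable_min_1 prob_space_axioms) auto
      show "integrable \<mu> (\<lambda>x. H * q ^ n + q ^ n * (1 + norm x))"
        using norm_int by simp
      fix x :: 'a
      have "norm x powr s \<le> 1 + norm x" using s by (intro powr_le_one_add) auto
      then have "r ^ n * norm x powr s \<le> q ^ n * (1 + norm x)"
        using r0 q by (intro mult_mono power_mono) auto
      then show "min 1 (H * q ^ n + r ^ n * norm x powr s) \<le> H * q ^ n + q ^ n * (1 + norm x)" by simp
    qed
    also have "\<dots> = H * q ^ n + q ^ n * (1 + (LINT x|\<mu>. norm x))"
      using norm_int by (simp add: prob_space)
    also have "\<dots> \<le> (H + 1) * q ^ n * (1 + (LINT x|\<mu>. norm x))"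
      using H0 I q by (simp add: algebra_simps)
    finally show "dist_BL (chain_law M S \<mu> n) (return borel 0) \<le> 2 * (H + 1) * q ^ n * (1 + (LINT x|\<mu>. norm x))"
      by (simp only: mult.assoc)
  qed (use q H0 in auto)
  assume \<mu>: "\<mu> \<in> borel_probs"
  show "weakly_converges (chain_law M S \<mu>) (return borel 0)"
  proof (rule weakly_converges_return_0[OF chain[OF \<mu>] s(1)])
    interpret prob_space \<mu> using \<mu> by (simp add: borel_probs_def)
    have [measurable]: "norm \<in> borel_measurable \<mu>"
      using \<mu> by (auto simp: borel_probs_def cong: measurable_cong_sets)
    have "(\<lambda>n. min 1 (H * q ^ n + r ^ n * norm x powr s)) \<longlonglongrightarrow> min 1 (H * 0 + 0 * norm x powr s)" for x :: 'a
      using q r r0 by (intro tendsto_intros LIMSEQ_power_zero) auto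
    \<comment> \<open>For an arbitrary initial law the truncation itself supplies the dominating
      constant 1.\<close>
    then have "(\<lambda>n. LINT x|\<mu>. min 1 (H * q ^ n + r ^ n * norm x powr s)) \<longlonglongrightarrow> (LINT x|\<mu>. 0)"
      using H0 q r0 by (intro integral_dominated_convergence[where w = "\<lambda>_. 1"]) (auto intro!: AE_I2)
    then have lim: "(\<lambda>n. LINT x|\<mu>. min 1 (H * q ^ n + r ^ n * norm x powr s)) \<longlonglongrightarrow> 0" by simp
    show "(\<lambda>n. LINT x|chain_law M S \<mu> n. min 1 (norm x powr s)) \<longlonglongrightarrow> 0"
      by (rule tendsto_sandwich[OF _ _ tendsto_const lim]) (auto simp: moment[OF \<mu>])
  qed
qed

section \<open>Contraction and decay of translations from (B1)-(B3)\<close>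

text \<open>Positive functions have the same preimage of \<open>E\<close> and of its positive part,
  so agreement on Borel subsets of the half-line is equality of laws.\<close>

lemma distr_eq_of_measure_pos_eq:
  fixes f :: "'s \<Rightarrow> real" and g :: "'t \<Rightarrow> real"
  assumes M: "prob_space M" and N: "prob_space N"
    and f [measurable]: "f \<in> borel_measurable M" and g [measurable]: "g \<in> borel_measurable N"
    and pos: "\<And>x. x \<in> space M \<Longrightarrow> f x > 0" "\<And>y. y \<in> space N \<Longrightarrow> g y > 0"
    and eq: "\<And>E. E \<in> sets borel \<Longrightarrow> E \<subseteq> {0<..} \<Longrightarrow>
      measure M (f -` E \<inter> space M) = measure N (g -` E \<inter> space N)"
  shows "distr M borel f = distr N borel g"
proof (rule measure_eqI)
  fix E :: "real set" assume "E \<in> sets (distr M borel f)"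
  then have E [measurable]: "E \<in> sets borel" by simp
  have "f -` E \<inter> space M = f -` (E \<inter> {0<..}) \<inter> space M" "g -` E \<inter> space N = g -` (E \<inter> {0<..}) \<inter> space N"
    using pos by auto
  then show "emeasure (distr M borel f) E = emeasure (distr N borel g) E"
    using eq[of "E \<inter> {0<..}"] M N
    by (simp add: emeasure_distr finite_measure.emeasure_eq_measure prob_space.finite_measure)
qed simp

theorem proposition4p1:
  fixes M :: "nat \<Rightarrow> 't measure"
    and scale :: "'k::real_normed_field \<Rightarrow> 'a::{banach, second_countable_topology} \<Rightarrow> 'a"
    and A :: "nat \<Rightarrow> 't \<Rightarrow> 'a \<Rightarrow> 'a"
    and b :: "nat \<Rightarrow> 't \<Rightarrow> 'a"
    and L :: "nat \<Rightarrow> 't \<Rightarrow> real"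
    and S :: "nat \<Rightarrow> 't \<Rightarrow> 'a \<Rightarrow> 'a"
    and R :: real
    and \<alpha> \<beta> \<gamma> \<delta> :: "nat \<Rightarrow> real"
  assumes "normed_space_over scale"
    and "\<And>n. n \<ge> 1 \<Longrightarrow> prob_space (M n)"
    and A_linear: "\<And>n \<theta>. n \<ge> 1 \<Longrightarrow> \<theta> \<in> space (M n) \<Longrightarrow> Vector_Spaces.linear scale scale (A n \<theta>)"
    and A_continuous: "\<And>n \<theta>. n \<ge> 1 \<Longrightarrow> \<theta> \<in> space (M n) \<Longrightarrow> bounded_linear (A n \<theta>)"
    and A_invertible: "\<And>n \<theta>. n \<ge> 1 \<Longrightarrow> \<theta> \<in> space (M n) \<Longrightarrow> bij (A n \<theta>)"
    and L_pos: "\<And>n \<theta>. n \<ge> 1 \<Longrightarrow> \<theta> \<in> space (M n) \<Longrightarrow> L n \<theta> > 0"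
    and "\<And>n. n \<ge> 1 \<Longrightarrow> b n \<in> borel_measurable (M n)"
    and "\<And>n. n \<ge> 1 \<Longrightarrow> L n \<in> borel_measurable (M n)"
    and "\<And>n. n \<ge> 1 \<Longrightarrow> (\<lambda>(x, \<theta>). A n \<theta> x) \<in> borel \<Otimes>\<^sub>M M n \<rightarrow>\<^sub>M borel"
    and "\<And>n. n \<ge> 1 \<Longrightarrow> (\<lambda>\<theta>. onorm (A n \<theta>)) \<in> borel_measurable (M n)"
    and "\<And>n. n \<ge> 1 \<Longrightarrow> (\<lambda>\<theta>. onorm (inv (A n \<theta>))) \<in> borel_measurable (M n)"
    and B1: "\<And>n \<theta>. n \<ge> 1 \<Longrightarrow> \<theta> \<in> space (M n) \<Longrightarrow> onorm (A n \<theta>) \<le> L n \<theta>"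
    and B2_law: "\<And>m n E. m \<ge> 1 \<Longrightarrow> n \<ge> 1 \<Longrightarrow> E \<in> sets borel \<Longrightarrow> E \<subseteq> {0<..} \<Longrightarrow>
        measure (M m) (L m -` E \<inter> space (M m)) = measure (M n) (L n -` E \<inter> space (M n))"
    and B2_integrable: "integrable (M 1) (L 1)"
    and R: "R = (LINT \<theta>|M 1. L 1 \<theta>)"
    and B2_ln: "ext_integral (M 1) (\<lambda>\<theta>. ln (L 1 \<theta>)) < 0"
    and B3_integrable:
      "\<And>n. n \<ge> 1 \<Longrightarrow> integrable (M n) (\<lambda>\<theta>. onorm (inv (A n \<theta>)))"
      "\<And>n. n \<ge> 1 \<Longrightarrow> integrable (M n) (\<lambda>\<theta>. norm (b n \<theta>) * onorm (inv (A n \<theta>)))"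
      "\<And>n. n \<ge> 1 \<Longrightarrow> integrable (M n) (\<lambda>\<theta>. onorm (A n \<theta>) * onorm (inv (A n \<theta>)))"
      "\<And>n. n \<ge> 1 \<Longrightarrow> integrable (M n) (\<lambda>\<theta>. norm (b n \<theta>))"
    and \<alpha>: "\<And>n. \<alpha> n = (LINT \<theta>|M n. onorm (inv (A n \<theta>)))"
    and \<beta>: "\<And>n. \<beta> n = (LINT \<theta>|M n. norm (b n \<theta>) * onorm (inv (A n \<theta>)))"
    and \<delta>: "\<And>n. \<delta> n = (LINT \<theta>|M n. onorm (A n \<theta>) * onorm (inv (A n \<theta>)))"
    and \<gamma>: "\<And>n. \<gamma> n = (LINT \<theta>|M n. norm (b n \<theta>))"
    and B3_prod: "convergent (\<lambda>N. \<Prod>n=1..N. \<delta> n)"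
    and B3_sum: "(\<lambda>n. \<beta> n / \<delta> n * (\<Prod>j=1..<n. \<alpha> j / \<delta> j)) summable_on {1..}"
    and B3_sup: "bdd_above ((\<lambda>n. \<gamma> n * (\<Prod>j=1..<n. \<alpha> j)) ` {1..})"
    and S: "\<And>n \<theta> x. S n \<theta> x = A n \<theta> x + b n \<theta>"
  shows "\<exists>\<pi> \<in> borel_probs.
      (\<exists>x\<^sub>0. \<exists>q \<in> {0<..<1}. \<exists>C \<ge> 0. \<forall>\<mu> \<in> borel_probs_fm. \<forall>n \<ge> 1.
        dist_BL (chain_law M S \<mu> n) \<pi> \<le> C * q ^ n * (1 + (LINT x|\<mu>. norm (x - x\<^sub>0)))) \<and>
      (\<forall>\<mu> \<in> borel_probs. weakly_converges (chain_law M S \<mu>) \<pi>) \<and>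
      (R < 1 \<longrightarrow> \<pi> \<in> borel_probs_fm)"
proof -
  \<comment> \<open>These are the data consumed by the convergence theorem. The contraction bound
    \<open>l\<close> is left open because it is \<open>L\<close> in general but 0 on the trivial
    space.\<close>
  have "\<exists>s l r G p. 0 < s \<and> s \<le> 1 \<and> r < 1 \<and> 0 \<le> p \<and> p < (1::real) \<and>
      (\<forall>n\<ge>1. (\<forall>\<theta>\<in>space (M n). 0 \<le> l n \<theta> \<and> (\<forall>x. norm (A n \<theta> x) \<le> l n \<theta> * norm x)) \<and>
        integrable (M n) (\<lambda>\<theta>. l n \<theta> powr s) \<and> (LINT \<theta>|M n. l n \<theta> powr s) \<le> r \<and>
        integrable (M n) (\<lambda>\<theta>. norm (b n \<theta>) powr s) \<and>
        (LINT \<theta>|M n. norm (b n \<theta>) powr s) \<le> G * p ^ n)"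
  proof (cases "\<forall>x::'a. x = 0")
    \<comment> \<open>On the trivial space the inverses have norm 0 and give no lower bound for the
      \<open>\<alpha> n\<close>; there all norms vanish and zero data suffice.\<close>
    case True
    then have norm_0: "norm x = 0" for x :: 'a by simp
    show ?thesis
      by (rule exI[of _ 1], rule exI[of _ "\<lambda>_ _. 0"],
          rule exI[of _ 0], rule exI[of _ 0], rule exI[of _ 0]) (simp add: norm_0)
  next
    case False
    then obtain v :: 'a where "v \<noteq> 0" by blast
    have inv_L_le: "1 / L n \<theta> \<le> onorm (inv (A n \<theta>))" if n: "n \<ge> 1" "\<theta> \<in> space (M n)" for n \<theta>
    proof -
      have "1 \<le> onorm (A n \<theta>) * onorm (inv (A n \<theta>))"
        by (rule one_le_onorm_mult_onorm_inv[OF A_continuous[OF n] A_invertible[OF n] \<open>v \<noteq> 0\<close>])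
      also have "\<dots> \<le> L n \<theta> * onorm (inv (A n \<theta>))"
        by (intro mult_right_mono B1 n onorm_pos_le bounded_linear_inv A_continuous A_invertible)
      finally show ?thesis using L_pos[OF n] by (simp add: field_simps)
    qed
    have inv_L_int: "integrable (M n) (\<lambda>\<theta>. 1 / L n \<theta>)" if n: "n \<ge> 1" for n
      using B3_integrable(1)[OF n]
    proof (rule Bochner_Integration.integrable_bound)
      show "(\<lambda>\<theta>. 1 / L n \<theta>) \<in> borel_measurable (M n)" using assms(8)[OF n] by measurable
      show "AE \<theta> in M n. norm (1 / L n \<theta>) \<le> norm (onorm (inv (A n \<theta>)))"
      proof (rule AE_I2)
        fix \<theta> assume "\<theta> \<in> space (M n)"
        then show "norm (1 / L n \<theta>) \<le> norm (onorm (inv (A n \<theta>)))"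
          using inv_L_le[OF n, of \<theta>] L_pos[OF n, of \<theta>] by simp
      qed
    qed
    interpret M1: prob_space "M 1" by (rule assms(2)) simp
    have L1_pos: "L 1 \<theta> > 0" if "\<theta> \<in> space (M 1)" for \<theta> using L_pos[of 1] that by simp
    have inv_L1_int: "integrable (M 1) (\<lambda>\<theta>. 1 / L 1 \<theta>)" by (rule inv_L_int) simp
    \<comment> \<open>Both \<open>L 1\<close> and its reciprocal are integrable, so the logarithmic
      integral is finite and the value -\<infinity> is excluded.\<close>
    have ln_int: "integrable (M 1) (\<lambda>\<theta>. ln (L 1 \<theta>))"
      by (rule M1.integrable_ln[OF B2_integrable inv_L1_int L1_pos])
    have ln_neg: "(LINT \<theta>|M 1. ln (L 1 \<theta>)) < 0"
      using B2_ln unfolding expectation_eq_ext_integral[OF ln_int] by simp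
    \<comment> \<open>Equality in law makes \<open>a\<close> a lower bound for every
      \<open>\<alpha> n\<close>; that it exceeds 1 is the source of the decay of
      \<open>\<gamma> n\<close>.\<close>
    define a where "a = (LINT \<theta>|M 1. 1 / L 1 \<theta>)"
    have a: "1 < a"
      unfolding a_def by (rule M1.expectation_inverse_gt_1[OF inv_L1_int ln_int L1_pos ln_neg])
    obtain s where s: "0 < s" "s \<le> 1" and s_int: "integrable (M 1) (\<lambda>\<theta>. L 1 \<theta> powr s)"
      and s_less: "(LINT \<theta>|M 1. L 1 \<theta> powr s) < 1"
      using M1.powr_moment_less_1[OF B2_integrable inv_L1_int L1_pos ln_neg] by blast
    have distr: "distr (M n) borel (L n) = distr (M 1) borel (L 1)" if n: "n \<ge> 1" for n
      by (rule distr_eq_of_measure_pos_eq[OF assms(2)[OF n] assms(2)[of 1] assms(8)[OF n] assms(8)[of 1]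
          L_pos[OF n] L_pos[of 1] B2_law[OF n, of 1]]) simp_all
    have L_law: "integrable (M n) (\<lambda>\<theta>. h (L n \<theta>)) \<longleftrightarrow> integrable (M 1) (\<lambda>\<theta>. h (L 1 \<theta>))"
      "(LINT \<theta>|M n. h (L n \<theta>)) = (LINT \<theta>|M 1. h (L 1 \<theta>))"
      if n: "n \<ge> 1" and h: "h \<in> borel_measurable borel" for n and h :: "real \<Rightarrow> real"
      using integrable_distr_eq[OF assms(8)[OF n] h] integrable_distr_eq[OF assms(8)[of 1] h]
        integral_distr[OF assms(8)[OF n] h] integral_distr[OF assms(8)[of 1] h] distr[OF n] by simp_all
    have \<alpha>_ge: "a \<le> \<alpha> n" if n: "n \<ge> 1" for n
    proof -
      have "a = (LINT \<theta>|M n. 1 / L n \<theta>)"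
        unfolding a_def by (rule L_law(2)[OF n, symmetric]) measurable
      also have "\<dots> \<le> \<alpha> n"
        unfolding \<alpha> by (rule integral_mono[OF inv_L_int[OF n] B3_integrable(1)[OF n] inv_L_le[OF n]])
      finally show ?thesis .
    qed
    obtain K where K: "\<And>n. n \<ge> 1 \<Longrightarrow> \<gamma> n * (\<Prod>j=1..<n. \<alpha> j) \<le> K"
      using B3_sup unfolding bdd_above_def by auto
    \<comment> \<open>The maximum with 1 makes \<open>c n\<close> positive. The extra factor
      \<open>a\<close> compensates for the product in (B3) having only \<open>n - 1\<close>
      factors.\<close>
    define c where "c n = (max K 1 * a) / a ^ n" for n
    have c_pos: "c n > 0" for n using a by (simp add: c_def)
    have \<gamma>_le: "\<gamma> n \<le> c n" if n: "n \<ge> 1" for n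
    proof -
      have "a ^ (n - 1) = (\<Prod>j=1..<n. a)" by simp
      also have "\<dots> \<le> (\<Prod>j=1..<n. \<alpha> j)" using a \<alpha>_ge by (intro prod_mono) auto
      finally have "\<gamma> n * a ^ (n - 1) \<le> \<gamma> n * (\<Prod>j=1..<n. \<alpha> j)"
        by (intro mult_left_mono) (simp_all add: \<gamma>)
      also have "\<dots> \<le> max K 1" using K[OF n] by simp
      finally have "\<gamma> n * a ^ (n - 1) * a \<le> max K 1 * a" using a by (intro mult_right_mono) auto
      moreover have "a ^ n = a ^ (n - 1) * a" using n by (simp add: power_eq_if mult.commute)
      ultimately show ?thesis using a by (simp add: c_def pos_le_divide_eq mult.assoc)
    qed
    \<comment> \<open>Raising to the power \<open>s\<close> keeps the decay geometric, now with
      ratio \<open>1 / a powr s\<close>.\<close>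
    have c_powr: "2 * c n powr s = 2 * (max K 1 * a) powr s * (1 / a powr s) ^ n" for n
    proof -
      have "(a ^ n) powr s = (a powr s) ^ n" using a by (simp add: powr_power powr_realpow[symmetric] powr_powr mult.commute)
      then show ?thesis by (simp add: c_def powr_divide power_one_over field_simps)
    qed
    have b: "integrable (M n) (\<lambda>\<theta>. norm (b n \<theta>) powr s)"
      "(LINT \<theta>|M n. norm (b n \<theta>) powr s) \<le> 2 * (max K 1 * a) powr s * (1 / a powr s) ^ n"
      if n: "n \<ge> 1" for n
      using prob_space.expectation_powr_le[OF assms(2)[OF n] B3_integrable(4)[OF n] _ s c_pos[of n]] \<gamma>_le[OF n]
      by (simp_all add: \<gamma> c_powr)
    have l: "0 \<le> L n \<theta>" "norm (A n \<theta> x) \<le> L n \<theta> * norm x" if n: "n \<ge> 1" "\<theta> \<in> space (M n)" for n \<theta> x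
    proof -
      show "0 \<le> L n \<theta>" using L_pos[OF n] by simp
      show "norm (A n \<theta> x) \<le> L n \<theta> * norm x"
        by (rule order_trans[OF onorm[OF A_continuous[OF n]] mult_right_mono[OF B1[OF n]]]) simp
    qed
    have L_s: "integrable (M n) (\<lambda>\<theta>. L n \<theta> powr s)"
      "(LINT \<theta>|M n. L n \<theta> powr s) \<le> (LINT \<theta>|M 1. L 1 \<theta> powr s)" if n: "n \<ge> 1" for n
      using L_law[OF n, of "\<lambda>x. x powr s"] s_int by simp_all
    have "1 < a powr s" using a s by (simp add: gr_one_powr)
    then have p: "1 / a powr s < 1" using a by (simp add: divide_less_eq_1)
    show ?thesis
      by (rule exI[of _ s], rule exI[of _ L], rule exI[of _ "LINT \<theta>|M 1. L 1 \<theta> powr s"],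
          rule exI[of _ "2 * (max K 1 * a) powr s"], rule exI[of _ "1 / a powr s"])
        (use s s_less l L_s b p in auto)
  qed
  then obtain s l r G p where "0 < s" "s \<le> 1" "r < 1" "0 \<le> p" "p < (1::real)"
    and contr: "\<forall>n\<ge>1. (\<forall>\<theta>\<in>space (M n). 0 \<le> l n \<theta> \<and> (\<forall>x. norm (A n \<theta> x) \<le> l n \<theta> * norm x)) \<and>
        integrable (M n) (\<lambda>\<theta>. l n \<theta> powr s) \<and> (LINT \<theta>|M n. l n \<theta> powr s) \<le> r \<and>
        integrable (M n) (\<lambda>\<theta>. norm (b n \<theta>) powr s) \<and>
        (LINT \<theta>|M n. norm (b n \<theta>) powr s) \<le> G * p ^ n"
    by (elim exE conjE)
  have l: "0 \<le> l n \<theta>" "norm (A n \<theta> x) \<le> l n \<theta> * norm x" if "n \<ge> 1" "\<theta> \<in> space (M n)" for n \<theta> x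
    using contr that by simp_all
  have moments: "integrable (M n) (\<lambda>\<theta>. l n \<theta> powr s)" "(LINT \<theta>|M n. l n \<theta> powr s) \<le> r"
    "integrable (M n) (\<lambda>\<theta>. norm (b n \<theta>) powr s)" "(LINT \<theta>|M n. norm (b n \<theta>) powr s) \<le> G * p ^ n"
    if "n \<ge> 1" for n
    using contr that by simp_all
  note conv = affine_chain_law_converges_to_return_0[where M = M and A = A and b = b and S = S and l = l,
      OF assms(2) \<open>0 < s\<close> \<open>s \<le> 1\<close> assms(9,7) l(2,1) moments(1,2) \<open>r < 1\<close> moments(3,4) \<open>0 \<le> p\<close> \<open>p < 1\<close> S]
  \<comment> \<open>Under the Dirac measure at 0 the norm vanishes almost everywhere, so the limit
    has finite first moment.\<close>
  have "integrable (return borel 0) (norm :: 'a \<Rightarrow> real)"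
  proof -
    interpret prob_space "return borel (0 :: 'a)" by (rule prob_space_return) simp
    have "AE x in return borel (0 :: 'a). norm (norm x) \<le> 0" by (subst AE_return) auto
    then show ?thesis by (rule integrable_const_bound) simp
  qed
  then have "return borel (0 :: 'a) \<in> borel_probs_fm"
    by (simp add: borel_probs_fm_def return_in_borel_probs)
  moreover obtain q C where "q \<in> {0<..<1}" "C \<ge> 0" "\<And>\<mu> n. \<mu> \<in> borel_probs_fm \<Longrightarrow>
      dist_BL (chain_law M S \<mu> n) (return borel 0) \<le> C * q ^ n * (1 + (LINT x|\<mu>. norm x))"
    using conv(1) by blast
  then have "\<exists>x\<^sub>0. \<exists>q \<in> {0<..<1}. \<exists>C \<ge> 0. \<forall>\<mu> \<in> borel_probs_fm. \<forall>n \<ge> 1.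
      dist_BL (chain_law M S \<mu> n) (return borel 0) \<le> C * q ^ n * (1 + (LINT x|\<mu>. norm (x - x\<^sub>0)))"
    by (intro exI[of _ 0] bexI[of _ q] exI[of _ C]) auto
  ultimately show ?thesis
    using conv(2) by (intro bexI[OF _ return_in_borel_probs[of 0]]) auto
qed

end
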